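(* Let $A$ be the operator in $C[0,1]$ given by $D(A)=\{f\in C^2[0,1]:f'(0)=f'(1)=f(1)-f(0)\}$, $Af=f''$, and let $(e^{tA})_{t\ge0}$ be the strongly continuous semigroup on $C[0,1]$ generated by $A$. Then $(e^{tA})_{t\ge0}$ converges, as $t\to\infty$, towards a rank-2 projection. More precisely, for every $\epsilon>0$ such that $-\epsilon$ is strictly larger than the second largest eigenvalue of $A$ there is a constant $M=M(\epsilon)$ such that $$\|e^{tA}-P\|_{\mathcal L(C[0,1])}\le Me^{-\epsilon t},\qquad t\ge0,$$ where $P$ is the rank-2 projection $$Pf=(F_0f_{\rm even})f_0+(F_1f_{\rm odd})f_1,\qquad f\in C[0,1].$$
   Context: $C[0,1]$ is the Banach space of continuous functions on $[0,1]$ with the supremum norm. $F_if=\int_0^1x^if(x)\,dx$. For $f\in C[0,1]$, $f_{\rm even}(x)=\frac12[f(x)+f(1-x)]$ and $f_{\rm odd}(x)=\frac12[f(x)-f(1-x)]$. The functions $f_0,f_1\in C[0,1]$ are $f_0(x)=1$ and $f_1(x)=12x-6$. The largest eigenvalue of $A$ is $0$, of multiplicity 2; "second largest eigenvalue" refers to distinct eigenvalues, i.e. it is the largest strictly negative eigenvalue of $A$. *)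

theory Defs
  imports "HOL-Analysis.Analysis"
begin

section \<open>The Banach space $C[0,1]$\<close>

text \<open>
  The interval $[0,1]$ is made a (compact) metric space type, so that the library's space of
  bounded continuous functions over it, with its supremum norm, is $C[0,1]$ over the real scalars,
  and \<open>C01 \<Rightarrow>\<^sub>L C01\<close> with its operator norm is $\mathcal L(C[0,1])$.
\<close>

typedef unit_interval = "{0..1::real}"
  morphisms of_I to_I
  by (rule exI[of _ 0]) simp

instantiation unit_interval :: metric_space
begin

definition dist_unit_interval :: "unit_interval \<Rightarrow> unit_interval \<Rightarrow> real"
  where "dist_unit_interval x y = dist (of_I x) (of_I y)"

definition uniformity_unit_interval :: "(unit_interval \<times> unit_interval) filter"
  where "uniformity_unit_interval = (INF e\<in>{0 <..}. principal {(x, y). dist x y < e})"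

definition open_unit_interval :: "unit_interval set \<Rightarrow> bool"
  where "open_unit_interval S = (\<forall>x\<in>S. \<forall>\<^sub>F (x', y) in uniformity. x' = x \<longrightarrow> y \<in> S)"

instance
proof
  fix x y z :: unit_interval
  show "dist x y = 0 \<longleftrightarrow> x = y"
    by (simp add: dist_unit_interval_def of_I_inject)
  show "dist x y \<le> dist x z + dist y z"
    by (simp add: dist_unit_interval_def dist_triangle2)
qed (rule open_unit_interval_def uniformity_unit_interval_def)+

end

type_synonym C01 = "unit_interval \<Rightarrow>\<^sub>C real"

definition ev :: "C01 \<Rightarrow> real \<Rightarrow> real"
  where "ev f x = apply_bcontfun f (to_I x)"

lemma continuous_on_of_I: "continuous_on UNIV of_I"
  by (auto simp: continuous_on_iff dist_unit_interval_def)

lemma continuous_on_to_I: "continuous_on {0..1} to_I"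
  by (auto simp: continuous_on_iff dist_unit_interval_def to_I_inverse)

lemma compact_unit_interval: "compact (UNIV :: unit_interval set)"
proof -
  have "to_I ` {0..1} = UNIV"
    using type_definition.Abs_image[OF type_definition_unit_interval] .
  with compact_continuous_image[OF continuous_on_to_I] show ?thesis
    by simp
qed

lemma continuous_on_ev: "continuous_on {0..1} (ev f)"
  unfolding ev_def
  by (rule continuous_on_compose2[OF continuous_on_apply_bcontfun[of UNIV] continuous_on_to_I]) auto

lemma continuous_imp_bcontfun:
  assumes "continuous_on {0..1} (g :: real \<Rightarrow> real)"
  shows "(\<lambda>x. g (of_I x)) \<in> bcontfun"
proof -
  have c: "continuous_on UNIV (\<lambda>x. g (of_I x))"
    by (rule continuous_on_compose2[OF assms continuous_on_of_I]) (use of_I in auto)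
  then have "bounded (range (\<lambda>x. g (of_I x)))"
    using compact_continuous_image[OF c compact_unit_interval] compact_imp_bounded by blast
  with c show ?thesis
    by (simp add: bcontfun_def)
qed

text \<open>The element of $C[0,1]$ given by a real function (meaningful if it is continuous on $[0,1]$).\<close>

definition C01_of :: "(real \<Rightarrow> real) \<Rightarrow> C01"
  where "C01_of g = Bcontfun (\<lambda>x. g (of_I x))"

lemma apply_C01_of:
  assumes "continuous_on {0..1} g"
  shows "apply_bcontfun (C01_of g) x = g (of_I x)"
  using continuous_imp_bcontfun[OF assms] by (simp add: C01_of_def Bcontfun_inverse)

lemma ev_C01_of:
  assumes "continuous_on {0..1} g" "x \<in> {0..1}"
  shows "ev (C01_of g) x = g x"
  using assms by (simp add: ev_def apply_C01_of to_I_inverse)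

lemma C01_eqI:
  assumes "\<And>x. x \<in> {0..1} \<Longrightarrow> ev f x = ev g x"
  shows "f = g"
proof (rule bcontfun_eqI)
  fix x
  show "apply_bcontfun f x = apply_bcontfun g x"
    using assms[OF of_I[of x]] by (simp add: ev_def of_I_inverse)
qed

lemma ev_add: "ev (f + g) x = ev f x + ev g x"
  and ev_scaleR: "ev (r *\<^sub>R f) x = r * ev f x"
  and abs_ev_le_norm: "\<bar>ev f x\<bar> \<le> norm f"
  using norm_bounded[of f "to_I x"] by (simp_all add: ev_def plus_bcontfun.rep_eq scaleR_bcontfun.rep_eq)


section \<open>Differentiation in $C[0,1]$\<close>

text \<open>Derivatives are taken within $[0,1]$, hence are one-sided at the endpoints.\<close>

definition has_deriv01 :: "C01 \<Rightarrow> C01 \<Rightarrow> bool"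
  where "has_deriv01 f g \<longleftrightarrow>
    (\<forall>x\<in>{0..1}. (ev f has_real_derivative ev g x) (at x within {0..1}))"

definition C1 :: "C01 set"
  where "C1 = {f. \<exists>g. has_deriv01 f g}"

definition deriv01 :: "C01 \<Rightarrow> C01"
  where "deriv01 f = (THE g. has_deriv01 f g)"

definition C2 :: "C01 set"
  where "C2 = {f \<in> C1. deriv01 f \<in> C1}"

lemma has_deriv01_unique:
  assumes "has_deriv01 f g" "has_deriv01 f h"
  shows "g = h"
proof (rule C01_eqI)
  fix x :: real
  assume x: "x \<in> {0..1}"
  have "(ev f has_vector_derivative ev g x) (at x within cbox 0 1)"
    "(ev f has_vector_derivative ev h x) (at x within cbox 0 1)"
    using assms x by (auto simp: has_deriv01_def has_real_derivative_iff_has_vector_derivative)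
  with x show "ev g x = ev h x"
    by (intro vector_derivative_unique_within_closed_interval[of 0 1 x "ev f"]) auto
qed

lemma deriv01_eq: "has_deriv01 f g \<Longrightarrow> deriv01 f = g"
  unfolding deriv01_def by (blast intro: has_deriv01_unique)


section \<open>Semigroups, generators and eigenvalues\<close>

text \<open>Only the values of \<open>T\<close> at times $t \ge 0$ matter.\<close>

definition C0_semigroup :: "(real \<Rightarrow> 'a::real_normed_vector \<Rightarrow>\<^sub>L 'a) \<Rightarrow> bool"
  where "C0_semigroup T \<longleftrightarrow>
    T 0 = id_blinfun \<and>
    (\<forall>s\<ge>0. \<forall>t\<ge>0. T (s + t) = T s o\<^sub>L T t) \<and>
    (\<forall>f. continuous_on {0..} (\<lambda>t. T t f))"

text \<open>
  An unbounded operator is given by its domain \<open>D\<close> and a function \<open>A\<close> whose values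
  outside \<open>D\<close> are irrelevant.
\<close>

definition generator :: "(real \<Rightarrow> 'a::real_normed_vector \<Rightarrow>\<^sub>L 'a) \<Rightarrow> 'a set \<Rightarrow> ('a \<Rightarrow> 'a) \<Rightarrow> bool"
  where "generator T D A \<longleftrightarrow>
    D = {f. \<exists>g. ((\<lambda>h. (T h f - f) /\<^sub>R h) \<longlongrightarrow> g) (at_right 0)} \<and>
    (\<forall>f\<in>D. ((\<lambda>h. (T h f - f) /\<^sub>R h) \<longlongrightarrow> A f) (at_right 0))"

definition eigenvalue :: "'a::real_vector set \<Rightarrow> ('a \<Rightarrow> 'a) \<Rightarrow> real \<Rightarrow> bool"
  where "eigenvalue D A \<mu> \<longleftrightarrow> (\<exists>f\<in>D. f \<noteq> 0 \<and> A f = \<mu> *\<^sub>R f)"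


section \<open>The operator and the projection\<close>

definition dom_A :: "C01 set"
  where "dom_A = {f \<in> C2. ev (deriv01 f) 0 = ev f 1 - ev f 0 \<and> ev (deriv01 f) 1 = ev f 1 - ev f 0}"

definition op_A :: "C01 \<Rightarrow> C01"
  where "op_A f = deriv01 (deriv01 f)"

text \<open>
  The largest eigenvalue of the operator is $0$, so the second largest among its distinct
  eigenvalues is the largest strictly negative one.
\<close>

definition second_largest_eigenvalue :: real
  where "second_largest_eigenvalue = (GREATEST \<mu>. eigenvalue dom_A op_A \<mu> \<and> \<mu> < 0)"

definition F :: "nat \<Rightarrow> C01 \<Rightarrow> real"
  where "F i f = integral {0..1} (\<lambda>x. x ^ i * ev f x)"

definition even_part :: "C01 \<Rightarrow> C01"
  where "even_part f = C01_of (\<lambda>x. (ev f x + ev f (1 - x)) / 2)"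

definition odd_part :: "C01 \<Rightarrow> C01"
  where "odd_part f = C01_of (\<lambda>x. (ev f x - ev f (1 - x)) / 2)"

definition f0 :: C01
  where "f0 = C01_of (\<lambda>x. 1)"

definition f1 :: C01
  where "f1 = C01_of (\<lambda>x. 12 * x - 6)"

lemma continuous_on_ev_reflect: "continuous_on {0..1} (\<lambda>x. ev f (1 - x))"
  by (rule continuous_on_compose2[OF continuous_on_ev]) (auto intro!: continuous_intros)

lemma ev_even_part: "x \<in> {0..1} \<Longrightarrow> ev (even_part f) x = (ev f x + ev f (1 - x)) / 2"
  and ev_odd_part: "x \<in> {0..1} \<Longrightarrow> ev (odd_part f) x = (ev f x - ev f (1 - x)) / 2"
  unfolding even_part_def odd_part_def
  by (rule ev_C01_of; auto intro!: continuous_intros continuous_on_ev continuous_on_ev_reflect)+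

lemma bounded_linear_even_part: "bounded_linear even_part"
proof (rule bounded_linear_intro[where K = 1])
  fix f g :: C01 and r :: real
  show "even_part (f + g) = even_part f + even_part g"
    by (rule C01_eqI) (simp add: ev_even_part ev_add field_simps)
  show "even_part (r *\<^sub>R f) = r *\<^sub>R even_part f"
    by (rule C01_eqI) (simp add: ev_even_part ev_scaleR field_simps)
  show "norm (even_part f) \<le> norm f * 1"
  proof (rule norm_bound)
    fix x
    have "\<bar>ev (even_part f) (of_I x)\<bar> \<le> norm f"
      using abs_ev_le_norm[of f "of_I x"] abs_ev_le_norm[of f "1 - of_I x"]
      by (simp add: ev_even_part of_I[simplified])
    then show "norm (apply_bcontfun (even_part f) x) \<le> norm f * 1"
      by (simp add: ev_def of_I_inverse)
  qed
qed

lemma bounded_linear_odd_part: "bounded_linear odd_part"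
proof (rule bounded_linear_intro[where K = 1])
  fix f g :: C01 and r :: real
  show "odd_part (f + g) = odd_part f + odd_part g"
    by (rule C01_eqI) (simp add: ev_odd_part ev_add field_simps)
  show "odd_part (r *\<^sub>R f) = r *\<^sub>R odd_part f"
    by (rule C01_eqI) (simp add: ev_odd_part ev_scaleR field_simps)
  show "norm (odd_part f) \<le> norm f * 1"
  proof (rule norm_bound)
    fix x
    have "\<bar>ev (odd_part f) (of_I x)\<bar> \<le> norm f"
      using abs_ev_le_norm[of f "of_I x"] abs_ev_le_norm[of f "1 - of_I x"]
      by (simp add: ev_odd_part of_I[simplified])
    then show "norm (apply_bcontfun (odd_part f) x) \<le> norm f * 1"
      by (simp add: ev_def of_I_inverse)
  qed
qed

lemma integrable_moment: "(\<lambda>x. x ^ i * ev f x) integrable_on {0..1}"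
  by (rule integrable_continuous_real) (intro continuous_intros continuous_on_ev)

lemma bounded_linear_F: "bounded_linear (F i)"
proof (rule bounded_linear_intro[where K = 1])
  fix f g :: C01 and r :: real
  show "F i (f + g) = F i f + F i g"
    by (simp add: F_def ev_add distrib_left integral_add integrable_moment)
  have "(\<lambda>x. x ^ i * ev (r *\<^sub>R f) x) = (\<lambda>x. r * (x ^ i * ev f x))"
    by (simp add: ev_scaleR fun_eq_iff)
  then show "F i (r *\<^sub>R f) = r *\<^sub>R F i f"
    by (simp add: F_def)
  have "norm (integral {0..1} (\<lambda>x. x ^ i * ev f x)) \<le> norm f * (1 - 0)"
  proof (rule integral_bound)
    show "continuous_on {0..1} (\<lambda>x. x ^ i * ev f x)"
      by (intro continuous_intros continuous_on_ev)
    fix t :: real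
    assume t: "t \<in> {0..1}"
    have "\<bar>t ^ i\<bar> * \<bar>ev f t\<bar> \<le> 1 * norm f"
      using t by (intro mult_mono abs_ev_le_norm) (auto simp: power_le_one)
    then show "norm (t ^ i * ev f t) \<le> norm f"
      by (simp add: abs_mult)
  qed simp
  then show "norm (F i f) \<le> norm f * 1"
    by (simp add: F_def)
qed

lift_definition P :: "C01 \<Rightarrow>\<^sub>L C01"
  is "\<lambda>f. F 0 (even_part f) *\<^sub>R f0 + F 1 (odd_part f) *\<^sub>R f1"
  by (intro bounded_linear_add bounded_linear_scaleR_const
      bounded_linear_compose[OF bounded_linear_F bounded_linear_even_part]
      bounded_linear_compose[OF bounded_linear_F bounded_linear_odd_part])

end

theory Submission
  imports Defs
begin

text \<open>
  With respect to the $L^2$ inner product, $A$ is symmetric, its kernel consists of the affine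
  functions, $P$ is the orthogonal projection onto the kernel, and $-\langle Af, f\rangle$ is the
  variance $q(f)$ of $f'$. Subtracting from $f$ its chord through the endpoints gives a function $w$
  with $w(0) = w(1)$ and $q(f) = \|w'\|_2^2$. Hence the sharp periodic Poincare inequality
  gives $q(f) \ge \mu^2 \|f\|_2^2$ for all $\mu < 2\pi$ if $Pf = 0$, while $\cos(2\pi x)$ is an
  eigenfunction for $-4\pi^2$; this locates the second largest eigenvalue. For an orbit $u$ in the
  complement of the kernel, $\|u\|_2^2$ has derivative $-2q(u)$, so it decays like
  $e^{-2\mu^2t}$; as $q(u)$ is nonincreasing, $2q(u(t+1)) \le \|u(t)\|_2^2$ decays at the same
  rate, and $q(u)^{1/2}$ controls the supremum norm of $u = w - Pw$. The estimate extends from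
  $D(A^2)$ to all of $C[0,1]$ by density.
\<close>


section \<open>Strongly continuous semigroups\<close>

text \<open>Completeness feeds the Baire argument and the vector-valued integrals of orbits
  below.\<close>

instance bcontfun :: (metric_space, banach) banach ..

text \<open>Baire category: the closed sets \<open>G n\<close> of vectors on which the family is
  bounded by \<open>n\<close> exhaust the space, so one of them contains a ball, and differences of
  points of that ball reach every direction.\<close>

lemma uniform_boundedness:
  fixes T :: "'i \<Rightarrow> 'a::banach \<Rightarrow>\<^sub>L 'b::real_normed_vector"
  assumes "\<And>f. bounded ((\<lambda>i. T i f) ` S)"
  obtains K where "\<And>i. i \<in> S \<Longrightarrow> norm (T i) \<le> K"
proof -
  define G where "G n = {f. \<forall>i\<in>S. norm (T i f) \<le> real n}" for n
  have cl: "closed (G n)" for n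
  proof -
    have "G n = (\<Inter>i\<in>S. {f. norm (T i f) \<le> real n})"
      by (auto simp: G_def)
    then show ?thesis
      by (auto intro!: closed_INT closed_Collect_le continuous_intros)
  qed
  have un: "(\<Union>n. G n) = UNIV"
  proof -
    have "\<exists>n. f \<in> G n" for f
    proof -
      obtain b where "\<And>i. i \<in> S \<Longrightarrow> norm (T i f) \<le> b"
        using assms[of f] by (auto simp: bounded_iff)
      moreover obtain n where "b \<le> real n"
        using real_arch_simple by blast
      ultimately show ?thesis
        by (auto simp: G_def intro: order_trans)
    qed
    then show ?thesis by auto
  qed
  have "\<exists>n. interior (G n) \<noteq> {}"
  proof (rule ccontr)
    assume *: "\<not> ?thesis"
    have "euclidean interior_of (\<Union> (range G)) = {}"
    proof (rule Baire_category_alt)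
      show "completely_metrizable_space (euclidean :: 'a topology)
          \<or> locally_compact_space (euclidean :: 'a topology) \<and> regular_space (euclidean :: 'a topology)"
        using completely_metrizable_space_euclidean by blast
    qed (use cl * in auto)
    with un show False
      by simp
  qed
  then obtain n f e where e: "e > 0" "ball f e \<subseteq> G n"
    by (metis all_not_in_conv mem_interior)
  have "norm (T i) \<le> 4 * real n / e" if i: "i \<in> S" for i
  proof (rule norm_blinfun_bound)
    fix g
    show "norm (T i g) \<le> 4 * real n / e * norm g"
    proof (cases "g = 0")
      case False
      \<comment> \<open>Scales \<open>g\<close> to half the radius, so that
        \<open>f + c *\<^sub>R g\<close> stays inside the ball; the 4 in the bound is this 2 times
        the 2 from the triangle inequality.\<close>
      define c where "c = e / (2 * norm g)"
      have c: "c > 0" using e False by (simp add: c_def)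
      have "f \<in> G n" "f + c *\<^sub>R g \<in> G n"
        using e False by (auto intro!: subsetD[OF e(2)] simp: dist_norm c_def)
      then have "norm (T i f) \<le> n" "norm (T i (f + c *\<^sub>R g)) \<le> n"
        using i by (auto simp: G_def)
      moreover have "norm (T i (c *\<^sub>R g)) \<le> norm (T i (f + c *\<^sub>R g)) + norm (T i f)"
        using norm_triangle_ineq4[of "T i (f + c *\<^sub>R g)" "T i f"] by (simp add: blinfun.add_right)
      ultimately have "c * norm (T i g) \<le> 2 * n"
        using c by (simp add: blinfun.scaleR_right)
      then show ?thesis
        using e False by (simp add: c_def field_simps)
    qed simp
  qed (use e in auto)
  then show thesis by (rule that)
qed

text \<open>Dividing the remainder by \<open>y - x\<close> instead of its absolute value changes
  only a sign, which the norm ignores. This links derivatives with the difference quotients that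
  define the generator.\<close>

lemma has_vector_derivative_iff_quotient:
  "(f has_vector_derivative D) (at x within S) \<longleftrightarrow>
    ((\<lambda>y. (f y - f x) /\<^sub>R (y - x)) \<longlongrightarrow> D) (at x within S)"
proof -
  have "norm ((f y - f x - (y - x) *\<^sub>R D) /\<^sub>R norm (y - x)) = norm ((f y - f x) /\<^sub>R (y - x) - D)"
    if "y \<noteq> x" for y
  proof -
    have "(f y - f x) /\<^sub>R (y - x) - D = (f y - f x - (y - x) *\<^sub>R D) /\<^sub>R (y - x)"
      using that by (simp add: scaleR_diff_right)
    then show ?thesis by simp
  qed
  then have "((\<lambda>y. (f y - f x - (y - x) *\<^sub>R D) /\<^sub>R norm (y - x)) \<longlongrightarrow> 0) (at x within S) \<longleftrightarrow>
      ((\<lambda>y. (f y - f x) /\<^sub>R (y - x) - D) \<longlongrightarrow> 0) (at x within S)"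
    by (subst (1 2) tendsto_norm_zero_iff[symmetric]) (intro filterlim_cong refl, simp add: eventually_at_filter)
  then show ?thesis
    by (simp add: has_vector_derivative_def has_derivative_within LIM_zero_iff bounded_linear_scaleR_left
        divide_inverse_commute diff_diff_eq)
qed

section \<open>Orbits and their derivatives\<close>

locale C0_semigroup_generator =
  fixes T :: "real \<Rightarrow> 'a::banach \<Rightarrow>\<^sub>L 'a" and D :: "'a set" and A :: "'a \<Rightarrow> 'a"
  assumes semigroup: "C0_semigroup T" and generator: "generator T D A"
begin

lemma T_zero [simp]: "T 0 f = f"
  using semigroup by (simp add: C0_semigroup_def)

lemma T_add: "s \<ge> 0 \<Longrightarrow> t \<ge> 0 \<Longrightarrow> T (s + t) f = T s (T t f)"
  using semigroup by (simp add: C0_semigroup_def)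

lemma continuous_on_T: "continuous_on {0..} (\<lambda>t. T t f)"
  using semigroup by (simp add: C0_semigroup_def)

lemma quotient_tendsto: "f \<in> D \<Longrightarrow> ((\<lambda>h. (T h f - f) /\<^sub>R h) \<longlongrightarrow> A f) (at_right 0)"
  using generator by (simp add: generator_def)

lemma generatorI:
  assumes "((\<lambda>h. (T h f - f) /\<^sub>R h) \<longlongrightarrow> g) (at_right 0)"
  shows "f \<in> D" "A f = g"
proof -
  show "f \<in> D"
    using generator assms by (auto simp: generator_def)
  from tendsto_unique[OF _ quotient_tendsto[OF this] assms] show "A f = g"
    by simp
qed

text \<open>Orbits are continuous, hence bounded on compact time intervals; uniform boundedness
  makes the bound uniform in the vector.\<close>

lemma T_bounded:
  obtains K where "\<And>t. t \<in> {0..b} \<Longrightarrow> norm (T t) \<le> K"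
proof (rule uniform_boundedness[of T "{0..b}"])
  show "bounded ((\<lambda>t. T t f) ` {0..b})" for f
    by (intro compact_imp_bounded compact_continuous_image)
      (auto intro: continuous_on_subset[OF continuous_on_T])
qed (use that in blast)

text \<open>\<open>T t\<close> is bounded and commutes with \<open>T h\<close>, so it passes through
  the difference quotient of \<open>f\<close>.\<close>

lemma T_generator:
  assumes "f \<in> D" "t \<ge> 0"
  shows "T t f \<in> D" "A (T t f) = T t (A f)"
proof -
  have "((\<lambda>h. T t ((T h f - f) /\<^sub>R h)) \<longlongrightarrow> T t (A f)) (at_right 0)"
    by (intro tendsto_intros quotient_tendsto assms)
  moreover have "\<forall>\<^sub>F h in at_right 0. T t ((T h f - f) /\<^sub>R h) = (T h (T t f) - T t f) /\<^sub>R h"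
    unfolding eventually_at_right_field
    using assms(2) T_add[of t _ f] T_add[of _ t f]
    by (auto intro!: exI[of _ 1] simp: blinfun.scaleR_right blinfun.diff_right add.commute)
  ultimately have "((\<lambda>h. (T h (T t f) - T t f) /\<^sub>R h) \<longlongrightarrow> T t (A f)) (at_right 0)"
    by (rule Lim_transform_eventually)
  from generatorI[OF this] show "T t f \<in> D" "A (T t f) = T t (A f)" .
qed

text \<open>The right derivative is the generator at \<open>T t f\<close>. On the left, the quotient
  at time \<open>t\<close> is \<open>T (t - h)\<close> applied to the quotient of the orbit at time
  0.\<close>

lemma has_vector_derivative_T:
  assumes f: "f \<in> D" and t: "t > 0"
  shows "((\<lambda>t. T t f) has_vector_derivative T t (A f)) (at t)"
proof -
  have right: "((\<lambda>h. (T h (T t f) - T t f) /\<^sub>R h) \<longlongrightarrow> T t (A f)) (at_right 0)"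
    using quotient_tendsto[OF T_generator(1)[OF f]] T_generator(2)[OF f] t by simp
  have R: "((\<lambda>h. (T (t + h) f - T t f) /\<^sub>R h) \<longlongrightarrow> T t (A f)) (at_right 0)"
  proof (rule Lim_transform_eventually[OF right])
    show "\<forall>\<^sub>F h in at_right 0. (T h (T t f) - T t f) /\<^sub>R h = (T (t + h) f - T t f) /\<^sub>R h"
      unfolding eventually_at_right_field
      using t T_add[of _ t f] by (auto intro!: exI[of _ 1] simp: add.commute)
  qed
  \<comment> \<open>\<open>T (t - h)\<close> moves with \<open>h\<close> and is only strongly
    continuous, so the error term is controlled by a norm bound uniform on
    \<open>{0..t}\<close>.\<close>
  obtain K where K: "\<And>s. s \<in> {0..t} \<Longrightarrow> norm (T s) \<le> K"
    using T_bounded by blast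
  have "((\<lambda>h. T (t - h) ((T h f - f) /\<^sub>R h - A f)) \<longlongrightarrow> 0) (at_right 0)"
  proof (rule tendsto_0_le)
    show "((\<lambda>h. (T h f - f) /\<^sub>R h - A f) \<longlongrightarrow> 0) (at_right 0)"
      using quotient_tendsto[OF f] LIM_zero by blast
    show "\<forall>\<^sub>F h in at_right 0. norm (T (t - h) ((T h f - f) /\<^sub>R h - A f))
        \<le> norm ((T h f - f) /\<^sub>R h - A f) * K"
      unfolding eventually_at_right_field using t
      by (auto intro!: exI[of _ t] order_trans[OF norm_blinfun] mult_right_mono K
          simp: mult.commute[of _ K])
  qed
  moreover have "((\<lambda>h. T (t - h) (A f)) \<longlongrightarrow> T t (A f)) (at_right 0)"
  proof -
    have "((\<lambda>s. T s (A f)) \<longlongrightarrow> T t (A f)) (at t)"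
      using continuous_on_T[of "A f"] t
      by (metis atLeast_iff at_within_interior continuous_on greaterThan_iff interior_real_atLeast less_imp_le)
    then show ?thesis
      by (rule filterlim_compose) (use t in \<open>auto intro!: tendsto_eq_intros simp: filterlim_at eventually_at_right_field intro!: exI[of _ t]\<close>)
  qed
  ultimately have "((\<lambda>h. T (t - h) ((T h f - f) /\<^sub>R h - A f) + T (t - h) (A f)) \<longlongrightarrow> 0 + T t (A f))
      (at_right 0)"
    by (rule tendsto_add)
  then have left: "((\<lambda>h. T (t - h) ((T h f - f) /\<^sub>R h)) \<longlongrightarrow> T t (A f)) (at_right 0)"
    by (simp add: blinfun.diff_right)
  have "((\<lambda>h. (T (t + - h) f - T t f) /\<^sub>R - h) \<longlongrightarrow> T t (A f)) (at_right 0)"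
  proof (rule Lim_transform_eventually[OF left])
    have "T (t - h) ((T h f - f) /\<^sub>R h) = (T (t + - h) f - T t f) /\<^sub>R - h" if "0 < h" "h < t" for h
      using that T_add[of "t - h" h f] by (simp add: blinfun.scaleR_right blinfun.diff_right algebra_simps)
    then show "\<forall>\<^sub>F h in at_right 0. T (t - h) ((T h f - f) /\<^sub>R h) = (T (t + - h) f - T t f) /\<^sub>R - h"
      unfolding eventually_at_right_field using t by blast
  qed
  then have L: "((\<lambda>h. (T (t + h) f - T t f) /\<^sub>R h) \<longlongrightarrow> T t (A f)) (at_left 0)"
    by (simp add: filterlim_at_left_to_right)
  from L R have "((\<lambda>h. (T (t + h) f - T t f) /\<^sub>R h) \<longlongrightarrow> T t (A f)) (at 0)"
    by (rule filterlim_split_at)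
  then have "((\<lambda>s. (T s f - T t f) /\<^sub>R (s - t)) \<longlongrightarrow> T t (A f)) (at t)"
    by (subst Lim_at_zero) (simp add: o_def)
  then show ?thesis
    by (simp add: has_vector_derivative_iff_quotient)
qed

section \<open>Time averages of orbits and density of the domains\<close>

lemma integrable_T: "0 \<le> a \<Longrightarrow> (\<lambda>s. T s f) integrable_on {a..b}"
  by (intro integrable_continuous_real continuous_on_subset[OF continuous_on_T]) auto

lemma integral_quotient_tendsto:
  assumes "t \<ge> 0"
  shows "((\<lambda>h. (integral {0..t + h} (\<lambda>s. T s f) - integral {0..t} (\<lambda>s. T s f)) /\<^sub>R h)
    \<longlongrightarrow> T t f) (at_right 0)"
proof -
  let ?I = "\<lambda>u. integral {0..u} (\<lambda>s. T s f)"
  have "(?I has_vector_derivative T t f) (at t within {0..t+1})"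
    using assms by (intro integral_has_vector_derivative continuous_on_subset[OF continuous_on_T]) auto
  then have "(?I has_vector_derivative T t f) (at t within {t..t+1})"
    by (rule has_vector_derivative_within_subset) (use assms in auto)
  then have "((\<lambda>u. (?I u - ?I t) /\<^sub>R (u - t)) \<longlongrightarrow> T t f) (at_right t)"
    by (simp add: has_vector_derivative_iff_quotient at_within_Icc_at_right)
  then show ?thesis
    by (simp add: filterlim_at_right_to_0[of _ _ t] add.commute)
qed

lemma average_tendsto: "((\<lambda>h. integral {0..h} (\<lambda>s. T s f) /\<^sub>R h) \<longlongrightarrow> f) (at_right 0)"
  using integral_quotient_tendsto[of 0 f] by simp

text \<open>Applying \<open>T k\<close> shifts the window of integration; what remains of the
  difference is one short integral at each end, and their averages tend to \<open>T h f\<close> and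
  \<open>f\<close>.\<close>

lemma generator_average:
  assumes h: "h > 0"
  shows "integral {0..h} (\<lambda>s. T s f) /\<^sub>R h \<in> D"
    "A (integral {0..h} (\<lambda>s. T s f) /\<^sub>R h) = (T h f - f) /\<^sub>R h"
proof -
  let ?I = "\<lambda>u. integral {0..u} (\<lambda>s. T s f)"
  have shift: "T k (?I h) = ?I (h + k) - ?I k" if k: "k > 0" for k
  proof -
    have "T k (?I h) = integral {0..h} (\<lambda>s. T k (T s f))"
      using integral_linear[OF integrable_T[of 0 f h] blinfun.bounded_linear_right[of "T k"]]
      by (simp add: o_def)
    also have "\<dots> = integral {0..h} (\<lambda>s. T (s + k) f)"
      using k T_add[of k _ f] by (intro integral_cong) (auto simp: add.commute)
    also have "\<dots> = integral {k..h + k} (\<lambda>s. T s f)"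
      using integral_shift_Icc_real[where c = k and a = 0 and b = h and f = "\<lambda>s. T s f"]
      by (simp add: o_def add.commute)
    also have "\<dots> = ?I (h + k) - ?I k"
      using Henstock_Kurzweil_Integration.integral_combine[of 0 k "h + k" "\<lambda>s. T s f"] k h integrable_T[of 0 f "h + k"]
      by (simp add: algebra_simps)
    finally show ?thesis .
  qed
  have "((\<lambda>k. ((?I (h + k) - ?I h) /\<^sub>R k - ?I k /\<^sub>R k) /\<^sub>R h) \<longlongrightarrow> (T h f - f) /\<^sub>R h) (at_right 0)"
    using h by (intro tendsto_intros integral_quotient_tendsto average_tendsto) auto
  moreover have "\<forall>\<^sub>F k in at_right 0. ((?I (h + k) - ?I h) /\<^sub>R k - ?I k /\<^sub>R k) /\<^sub>R h =
      (T k (?I h /\<^sub>R h) - ?I h /\<^sub>R h) /\<^sub>R k"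
    unfolding eventually_at_right_field
    by (intro exI[of _ 1]) (simp add: shift blinfun.scaleR_right algebra_simps)
  ultimately have "((\<lambda>k. (T k (?I h /\<^sub>R h) - ?I h /\<^sub>R h) /\<^sub>R k) \<longlongrightarrow> (T h f - f) /\<^sub>R h) (at_right 0)"
    by (rule Lim_transform_eventually)
  from generatorI[OF this] show "?I h /\<^sub>R h \<in> D" "A (?I h /\<^sub>R h) = (T h f - f) /\<^sub>R h" .
qed

text \<open>This form covers both uses below: difference quotients of orbits, and
  \<open>f - P f\<close> with \<open>c = 1\<close>.\<close>

lemma generator_diff_scale:
  assumes "f \<in> D" "g \<in> D"
  shows "(f - g) /\<^sub>R c \<in> D" "A ((f - g) /\<^sub>R c) = (A f - A g) /\<^sub>R c"
proof -
  have "((\<lambda>h. ((T h f - f) /\<^sub>R h - (T h g - g) /\<^sub>R h) /\<^sub>R c) \<longlongrightarrow> (A f - A g) /\<^sub>R c) (at_right 0)"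
    by (intro tendsto_intros quotient_tendsto assms)
  then have "((\<lambda>h. (T h ((f - g) /\<^sub>R c) - (f - g) /\<^sub>R c) /\<^sub>R h) \<longlongrightarrow> (A f - A g) /\<^sub>R c) (at_right 0)"
    by (simp add: blinfun.scaleR_right blinfun.diff_right algebra_simps)
  from generatorI[OF this]
  show "(f - g) /\<^sub>R c \<in> D" "A ((f - g) /\<^sub>R c) = (A f - A g) /\<^sub>R c" .
qed

lemma closure_generator_domain: "closure D = UNIV"
proof -
  have "f \<in> closure D" for f
    by (rule Lim_in_closed_set[OF closed_closure _ _ average_tendsto])
      (auto simp: eventually_at_right_field intro!: exI[of _ 1] subsetD[OF closure_subset] generator_average)
  then show ?thesis by blast
qed

text \<open>For \<open>f\<close> in \<open>D\<close>, the generator maps the average of the orbit to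
  a difference quotient of elements of \<open>D\<close>. So the averages lie in the domain of the
  square of \<open>A\<close> and still tend to \<open>f\<close>.\<close>

lemma closure_generator_domain2: "closure {f \<in> D. A f \<in> D} = UNIV"
proof -
  have "f \<in> closure {f \<in> D. A f \<in> D}" if "f \<in> D" for f
    by (rule Lim_in_closed_set[OF closed_closure _ _ average_tendsto])
      (use that in \<open>auto simp: eventually_at_right_field generator_average(2) intro!: exI[of _ 1] subsetD[OF closure_subset]
          generator_average(1) generator_diff_scale T_generator\<close>)
  then have "closure D \<subseteq> closure {f \<in> D. A f \<in> D}"
    by (intro closure_minimal) auto
  then show ?thesis
    by (simp add: closure_generator_domain top.extremum_unique)
qed

end


section \<open>The $L^2$ inner product and the projection\<close>

definition ip :: "C01 \<Rightarrow> C01 \<Rightarrow> real"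
  where "ip f g = integral {0..1} (\<lambda>x. ev f x * ev g x)"

lemma integrable_ip: "(\<lambda>x. ev f x * ev g x) integrable_on {0..1}"
  by (intro integrable_continuous_real continuous_intros continuous_on_ev)

lemma ip_commute: "ip f g = ip g f"
  by (simp add: ip_def mult.commute)

lemma ip_self_nonneg: "ip f f \<ge> 0"
  unfolding ip_def by (intro integral_nonneg integrable_ip) simp

lemma abs_ip_le: "\<bar>ip f g\<bar> \<le> norm f * norm g"
proof -
  have "norm (integral {0..1} (\<lambda>x. ev f x * ev g x)) \<le> norm f * norm g * (1 - 0)"
    by (intro integral_bound continuous_intros continuous_on_ev)
      (auto simp: abs_mult intro!: mult_mono abs_ev_le_norm)
  then show ?thesis
    by (simp add: ip_def)
qed

lemma bounded_bilinear_ip: "bounded_bilinear ip"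
proof
  fix a a' b b' :: C01 and r :: real
  show "ip (a + a') b = ip a b + ip a' b"
    by (simp add: ip_def ev_add distrib_right integral_add integrable_ip)
  show "ip a (b + b') = ip a b + ip a b'"
    by (simp add: ip_def ev_add distrib_left integral_add integrable_ip)
  show "ip (r *\<^sub>R a) b = r *\<^sub>R ip a b"
    by (simp add: ip_def ev_scaleR mult.assoc)
  show "ip a (r *\<^sub>R b) = r *\<^sub>R ip a b"
    by (simp add: ip_def ev_scaleR mult.left_commute[of _ r])
  show "\<exists>K. \<forall>a b. norm (ip a b) \<le> norm a * norm b * K"
    by (intro exI[of _ 1]) (simp add: abs_ip_le)
qed

interpretation ip: bounded_bilinear ip
  by (rule bounded_bilinear_ip)

lemma ip_self_eq_0: "ip f f = 0 \<Longrightarrow> f = 0"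
proof (rule C01_eqI)
  fix x :: real
  assume f: "ip f f = 0" and x: "x \<in> {0..1}"
  have "((\<lambda>x. ev f x * ev f x) has_integral 0) (cbox 0 1)"
    using integrable_integral[OF integrable_ip[of f f]] f by (simp add: ip_def)
  then have "ev f x * ev f x = 0"
    by (rule has_integral_0_cbox_imp_0[rotated 2])
      (use x in \<open>auto intro!: continuous_intros continuous_on_ev\<close>)
  then show "ev f x = ev 0 x"
    by (simp add: ev_def)
qed

lemma ev_zero [simp]: "ev 0 x = 0"
  by (simp add: ev_def)

section \<open>The projection as an orthogonal projection\<close>

lemma ev_f0: "x \<in> {0..1} \<Longrightarrow> ev f0 x = 1"
  and ev_f1: "x \<in> {0..1} \<Longrightarrow> ev f1 x = 12 * x - 6"
  by (simp_all add: f0_def f1_def ev_C01_of continuous_intros)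

lemma ev_diff: "ev (f - g) x = ev f x - ev g x"
  using ev_add[of "f - g" g x] by simp

lemma integral_polynomial_01:
  "integral {0..1} (\<lambda>x. a * x\<^sup>2 + b * x + c) = a / 3 + b / 2 + (c::real)"
proof -
  have "((\<lambda>x. a * x\<^sup>2 + b * x + c) has_integral
      (a * 1^3 / 3 + b * 1\<^sup>2 / 2 + c * 1) - (a * 0^3 / 3 + b * 0\<^sup>2 / 2 + c * 0)) {0..1}"
    by (rule fundamental_theorem_of_calculus)
      (auto intro!: derivative_eq_intros simp: has_real_derivative_iff_has_vector_derivative[symmetric] power2_eq_square)
  then show ?thesis
    by (simp add: integral_unique)
qed

lemma ip_f0_f0 [simp]: "ip f0 f0 = 1"
  and ip_f0_f1 [simp]: "ip f0 f1 = 0"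
  and ip_f1_f1 [simp]: "ip f1 f1 = 12"
proof -
  have "ip f0 f0 = integral {0..1} (\<lambda>x. 0 * x\<^sup>2 + 0 * x + 1)"
    unfolding ip_def by (intro integral_cong) (simp add: ev_f0)
  then show "ip f0 f0 = 1"
    by (simp only: integral_polynomial_01)
  have "ip f0 f1 = integral {0..1} (\<lambda>x. 0 * x\<^sup>2 + 12 * x + (-6))"
    unfolding ip_def by (intro integral_cong) (simp add: ev_f0 ev_f1)
  then show "ip f0 f1 = 0"
    by (simp only: integral_polynomial_01)
  have "ip f1 f1 = integral {0..1} (\<lambda>x. 144 * x\<^sup>2 + (-144) * x + 36)"
    unfolding ip_def by (intro integral_cong) (simp add: ev_f1 power2_eq_square algebra_simps)
  then show "ip f1 f1 = 12"
    by (simp only: integral_polynomial_01)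
qed

lemma integral_reflect_01:
  fixes g :: "real \<Rightarrow> real"
  assumes "continuous_on {0..1} g"
  shows "((\<lambda>x. g (1 - x)) has_integral integral {0..1} g) {0..1}"
proof -
  have "(g has_integral integral {0..1} g) (cbox 0 1)"
    using assms integrable_continuous_real integrable_integral by fastforce
  from has_integral_affinity[OF this, of "-1" 1] show ?thesis
    by (simp add: image_affinity_atLeastAtMost)
qed

text \<open>Substituting 1 - x for x moves the reflection from \<open>f\<close> to the weight: the
  even part yields weight 1, the odd part yields x/2 - (1 - x)/2 = x - 1/2, which is
  \<open>f1\<close> divided by 12. As \<open>f0\<close> and \<open>f1\<close> are orthogonal with
  squared lengths 1 and 12, this is the orthogonal projection onto their span.\<close>

lemma P_eq: "P f = ip f f0 *\<^sub>R f0 + (ip f f1 / 12) *\<^sub>R f1"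
proof -
  note c = continuous_intros continuous_on_ev continuous_on_ev_reflect
  have i: "(\<lambda>x. g x) integrable_on {0..1}" if "continuous_on {0..1} g" for g :: "real \<Rightarrow> real"
    using that by (rule integrable_continuous_real)
  have "F 0 (even_part f) = integral {0..1} (\<lambda>x. ev f x / 2 + ev f (1 - x) / 2)"
    unfolding F_def by (intro integral_cong) (simp add: ev_even_part field_simps)
  also have "\<dots> = integral {0..1} (\<lambda>x. ev f x / 2) + integral {0..1} (\<lambda>x. ev f (1 - x) / 2)"
    by (intro integral_add i c) auto
  also have "integral {0..1} (\<lambda>x. ev f (1 - x) / 2) = integral {0..1} (\<lambda>x. ev f x / 2)"
    by (intro integral_unique integral_reflect_01[of "\<lambda>x. ev f x / 2"] c) auto
  also have "integral {0..1} (\<lambda>x. ev f x / 2) = ip f f0 / 2"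
    unfolding ip_def by (subst integral_divide[symmetric]) (intro integral_cong, simp add: ev_f0)
  finally have even: "F 0 (even_part f) = ip f f0"
    by simp
  have "F 1 (odd_part f) = integral {0..1} (\<lambda>x. x * ev f x / 2 - x * ev f (1 - x) / 2)"
    unfolding F_def by (intro integral_cong) (simp add: ev_odd_part field_simps)
  also have "\<dots> = integral {0..1} (\<lambda>x. x * ev f x / 2) - integral {0..1} (\<lambda>x. x * ev f (1 - x) / 2)"
    by (intro integral_diff i c) auto
  also have "integral {0..1} (\<lambda>x. x * ev f (1 - x) / 2) = integral {0..1} (\<lambda>x. (1 - x) * ev f x / 2)"
  proof (rule integral_unique)
    have "continuous_on {0..1} (\<lambda>x. (1 - x) * ev f x / 2)"
      by (intro c) auto
    from integral_reflect_01[OF this]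
    show "((\<lambda>x. x * ev f (1 - x) / 2) has_integral integral {0..1} (\<lambda>x. (1 - x) * ev f x / 2)) {0..1}"
      by simp
  qed
  also have "integral {0..1} (\<lambda>x. x * ev f x / 2) - \<dots> =
      integral {0..1} (\<lambda>x. x * ev f x / 2 - (1 - x) * ev f x / 2)"
    by (intro integral_diff[symmetric] i c) auto
  also have "\<dots> = integral {0..1} (\<lambda>x. ev f x * ev f1 x / 12)"
    by (intro integral_cong) (simp add: ev_f1 field_simps)
  finally have "F 1 (odd_part f) = ip f f1 / 12"
    by (simp add: ip_def)
  with even show ?thesis
    by (simp add: P.rep_eq)
qed

lemma P_f0: "P f0 = f0" and P_f1: "P f1 = f1"
  by (simp_all add: P_eq ip_commute[of f1 f0])

lemma P_idem: "P (P f) = P f"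
  by (simp add: P_eq[of f] blinfun.add_right blinfun.scaleR_right P_f0 P_f1)

lemma P_eq_0_iff: "P f = 0 \<longleftrightarrow> ip f f0 = 0 \<and> ip f f1 = 0"
proof
  assume "P f = 0"
  then have "ip (P f) f0 = 0" "ip (P f) f1 = 0"
    by (simp_all add: ip.zero_left)
  then show "ip f f0 = 0 \<and> ip f f1 = 0"
    by (simp add: P_eq ip.add_left ip.scaleR_left ip_commute[of f1 f0])
qed (simp add: P_eq)

text \<open>Orthogonality makes \<open>f0\<close> and \<open>f1\<close> independent, and
  \<open>P\<close> fixes both, so its range is exactly their span.\<close>

lemma dim_range_P: "dim (range P) = 2"
proof -
  have ne: "f0 \<noteq> f1"
    using ip_f0_f0 ip_f0_f1 by force
  have "f1 \<noteq> 0"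
    using ip_f1_f1 by (metis ip.zero_left zero_neq_numeral)
  moreover have "f0 \<notin> span {f1}"
  proof
    assume "f0 \<in> span {f1}"
    then obtain k where "f0 = k *\<^sub>R f1"
      by (auto simp: span_singleton)
    then have "ip f0 f0 = k * ip f1 f0"
      by (metis ip.scaleR_left real_scaleR_def)
    then show False
      by (simp add: ip_commute[of f1 f0])
  qed
  ultimately have "independent {f0, f1}"
    by (simp add: independent_insert ne)
  then have "dim (span {f0, f1}) = card {f0, f1}"
    by (rule dim_span_eq_card_independent)
  moreover have "span {f0, f1} = range P"
  proof (intro equalityI subsetI)
    fix f
    assume "f \<in> span {f0, f1}"
    then obtain k where "f - k *\<^sub>R f0 \<in> span {f1}"
      by (auto simp: span_insert)
    then obtain l where "f - k *\<^sub>R f0 = l *\<^sub>R f1"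
      by (auto simp: span_singleton)
    then have "f = P (k *\<^sub>R f0 + l *\<^sub>R f1)"
      by (simp add: blinfun.add_right blinfun.scaleR_right P_f0 P_f1 algebra_simps)
    then show "f \<in> range P"
      by blast
  qed (auto simp: P_eq intro!: span_add span_scale intro: span_base)
  ultimately show ?thesis
    using ne by simp
qed


section \<open>The quadratic form of the operator\<close>

lemma has_deriv01_deriv01: "f \<in> C1 \<Longrightarrow> has_deriv01 f (deriv01 f)"
  unfolding C1_def using deriv01_eq by blast

lemma dom_AD:
  assumes "f \<in> dom_A"
  shows "has_deriv01 f (deriv01 f)" "has_deriv01 (deriv01 f) (op_A f)"
    "ev (deriv01 f) 0 = ev f 1 - ev f 0" "ev (deriv01 f) 1 = ev f 1 - ev f 0"
  using assms by (auto simp: dom_A_def C2_def op_A_def intro!: has_deriv01_deriv01)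

lemma dom_AI:
  assumes "has_deriv01 f g" "has_deriv01 g h" "ev g 0 = ev f 1 - ev f 0" "ev g 1 = ev f 1 - ev f 0"
  shows "f \<in> dom_A" "op_A f = h"
  using assms deriv01_eq[OF assms(1)] deriv01_eq[OF assms(2)]
  by (auto simp: dom_A_def C2_def op_A_def C1_def)

lemma has_deriv01_add_scaleR:
  assumes "has_deriv01 f f'" "has_deriv01 g g'"
  shows "has_deriv01 (f + r *\<^sub>R g) (f' + r *\<^sub>R g')"
proof -
  have "ev (f + r *\<^sub>R g) = (\<lambda>x. ev f x + r * ev g x)"
    by (simp add: fun_eq_iff ev_add ev_scaleR)
  with assms show ?thesis
    by (auto simp: has_deriv01_def ev_add ev_scaleR intro!: derivative_eq_intros)
qed

lemma has_deriv01_C01_of: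
  assumes "\<And>x. x \<in> {0..1} \<Longrightarrow> (g has_real_derivative g' x) (at x within {0..1})"
    and "continuous_on {0..1} g'"
  shows "has_deriv01 (C01_of g) (C01_of g')"
  unfolding has_deriv01_def
proof
  fix x :: real
  assume x: "x \<in> {0..1}"
  have g: "continuous_on {0..1} g"
    using assms(1) by (rule DERIV_continuous_on)
  show "(ev (C01_of g) has_real_derivative ev (C01_of g') x) (at x within {0..1})"
    unfolding has_field_derivative_def ev_C01_of[OF assms(2) x]
    by (rule has_derivative_transform[OF x _ assms(1)[OF x, unfolded has_field_derivative_def]])
      (rule ev_C01_of[OF g])
qed

lemma has_deriv01_f0: "has_deriv01 f0 0"
  and has_deriv01_f1: "has_deriv01 f1 (12 *\<^sub>R f0)"
proof -
  have "has_deriv01 f0 (C01_of (\<lambda>x. 0))"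
    unfolding f0_def by (intro has_deriv01_C01_of) auto
  also have "C01_of (\<lambda>x. 0) = 0"
    by (rule C01_eqI) (simp add: ev_C01_of)
  finally show "has_deriv01 f0 0" .
  have "has_deriv01 f1 (C01_of (\<lambda>x. 12))"
    unfolding f1_def by (intro has_deriv01_C01_of) (auto intro!: derivative_eq_intros)
  also have "C01_of (\<lambda>x. 12) = 12 *\<^sub>R f0"
    by (rule C01_eqI) (simp add: ev_C01_of ev_scaleR ev_f0)
  finally show "has_deriv01 f1 (12 *\<^sub>R f0)" .
qed

lemma has_deriv01_zero: "has_deriv01 0 0"
proof -
  have "ev 0 = (\<lambda>x. 0)"
    by (simp add: fun_eq_iff)
  then show ?thesis
    by (simp add: has_deriv01_def)
qed

lemma f0_in_dom_A: "f0 \<in> dom_A" and op_A_f0: "op_A f0 = 0"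
proof -
  from dom_AI[OF has_deriv01_f0 has_deriv01_zero] show "f0 \<in> dom_A" "op_A f0 = 0"
    by (simp_all add: ev_f0)
qed

lemma f1_in_dom_A: "f1 \<in> dom_A" and op_A_f1: "op_A f1 = 0"
proof -
  have "has_deriv01 (12 *\<^sub>R f0) 0"
    using has_deriv01_add_scaleR[OF has_deriv01_zero has_deriv01_f0, of 12] by simp
  from dom_AI[OF has_deriv01_f1 this] show "f1 \<in> dom_A" "op_A f1 = 0"
    by (simp_all add: ev_f0 ev_f1 ev_scaleR)
qed

text \<open>The quadratic form of \<open>- op_A\<close>, which is the variance of $f'$.\<close>

definition energy :: "C01 \<Rightarrow> real"
  where "energy f = ip (deriv01 f) (deriv01 f) - (ev f 1 - ev f 0)\<^sup>2"

lemma integral_has_deriv01: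
  assumes "has_deriv01 f g"
  shows "(ev g has_integral ev f 1 - ev f 0) {0..1}"
  using assms
  by (intro fundamental_theorem_of_calculus)
    (auto simp: has_deriv01_def has_real_derivative_iff_has_vector_derivative)

text \<open>Integrate the derivative of f' g over [0,1]: both boundary slopes of \<open>f\<close>
  equal its increment, which factors out of the boundary term. The right side is symmetric in
  \<open>f\<close> and \<open>g\<close>.\<close>

lemma green_op_A:
  assumes f: "f \<in> dom_A" and g: "g \<in> dom_A"
  shows "ip (op_A f) g = (ev f 1 - ev f 0) * (ev g 1 - ev g 0) - ip (deriv01 f) (deriv01 g)"
proof -
  have "((\<lambda>x. ev (op_A f) x * ev g x + ev (deriv01 f) x * ev (deriv01 g) x) has_integral
      ev (deriv01 f) 1 * ev g 1 - ev (deriv01 f) 0 * ev g 0) {0..1}"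
    using dom_AD[OF f] dom_AD[OF g]
    by (intro fundamental_theorem_of_calculus)
      (auto simp: has_deriv01_def has_real_derivative_iff_has_vector_derivative[symmetric]
        intro!: derivative_eq_intros)
  then have "ip (op_A f) g + ip (deriv01 f) (deriv01 g) =
      ev (deriv01 f) 1 * ev g 1 - ev (deriv01 f) 0 * ev g 0"
    by (simp add: ip_def integral_add[symmetric] integrable_ip integral_unique)
  then show ?thesis
    using dom_AD[OF f] by (simp add: algebra_simps)
qed

lemma op_A_symmetric: "f \<in> dom_A \<Longrightarrow> g \<in> dom_A \<Longrightarrow> ip (op_A f) g = ip f (op_A g)"
  using green_op_A[of f g] green_op_A[of g f] by (simp add: ip_commute mult.commute)

lemma energy_eq: "f \<in> dom_A \<Longrightarrow> energy f = - ip (op_A f) f"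
  by (simp add: green_op_A energy_def power2_eq_square)

text \<open>The increment of \<open>f\<close> is the mean of f', so \<open>h\<close> is f' minus its
  mean. No boundary condition enters.\<close>

lemma energy_eq_ip:
  assumes "f \<in> C1"
  defines "h \<equiv> deriv01 f - (ev f 1 - ev f 0) *\<^sub>R f0"
  shows "energy f = ip h h"
proof -
  have "ip (deriv01 f) f0 = integral {0..1} (ev (deriv01 f))"
    unfolding ip_def by (intro integral_cong) (simp add: ev_f0)
  also have "\<dots> = ev f 1 - ev f 0"
    using integral_has_deriv01[OF has_deriv01_deriv01[OF assms(1)]] by (simp add: integral_unique)
  finally show ?thesis
    using ip_commute[of f0 "deriv01 f"]
    by (simp add: h_def ip.diff_left ip.diff_right ip.scaleR_left ip.scaleR_right energy_def
        power2_eq_square)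
qed

section \<open>Control of the supremum norm by the energy\<close>

lemma norm_C01_le:
  assumes "\<And>x. x \<in> {0..1} \<Longrightarrow> \<bar>ev f x\<bar> \<le> b"
  shows "norm f \<le> b"
proof (rule norm_bound)
  show "norm (apply_bcontfun f x) \<le> b" for x
    using assms[OF of_I[of x]] by (simp add: ev_def of_I_inverse)
qed

text \<open>Without its chord \<open>l\<close>, the function vanishes at 0 and has derivative
  \<open>h\<close>, so Cauchy-Schwarz bounds \<open>w\<close>. The chord is recovered from
  \<open>w\<close>: since \<open>P l = l\<close> and \<open>P f = 0\<close>, one has
  \<open>P w = - l\<close>.\<close>

lemma norm_le_energy:
  assumes f: "f \<in> C1" and P: "P f = 0"
  shows "norm f \<le> (1 + norm P) * sqrt (energy f)"
proof -
  define d where "d = ev f 1 - ev f 0"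
  \<comment> \<open>As \<open>f1\<close> divided by 12 is x - 1/2, this is the chord f(0) + d
    x.\<close>
  define l where "l = (ev f 0 + d / 2) *\<^sub>R f0 + (d / 12) *\<^sub>R f1"
  define w where "w = f - l"
  define s where "s = sqrt (energy f)"
  have w: "ev w x = ev f x - ev f 0 - d * x" if "x \<in> {0..1}" for x
    using that by (simp add: w_def l_def ev_diff ev_add ev_scaleR ev_f0 ev_f1 algebra_simps)
  have der: "has_deriv01 f (deriv01 f)"
    using f by (rule has_deriv01_deriv01)
  define h where "h = deriv01 f - d *\<^sub>R f0"
  have h: "ip h h = energy f"
    using energy_eq_ip[OF f] by (simp add: h_def d_def)
  have "\<bar>ev w x\<bar> \<le> s" if x: "x \<in> {0..1}" for x
  proof -
    define c where "c = ev w x"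
    have "(ev h has_integral (ev f x - d * x) - (ev f 0 - d * 0)) {0..x}"
    proof (rule fundamental_theorem_of_calculus)
      fix y
      assume y: "y \<in> {0..x}"
      then have "(ev f has_real_derivative ev (deriv01 f) y) (at y within {0..1})"
        using der x by (auto simp: has_deriv01_def)
      then have "(ev f has_real_derivative ev (deriv01 f) y) (at y within {0..x})"
        by (rule DERIV_subset) (use x in auto)
      then have "((\<lambda>x. ev f x - d * x) has_real_derivative ev (deriv01 f) y - d) (at y within {0..x})"
        by (auto intro!: derivative_eq_intros)
      then show "((\<lambda>x. ev f x - d * x) has_vector_derivative ev h y) (at y within {0..x})"
        using x y by (simp add: h_def ev_diff ev_scaleR ev_f0 has_real_derivative_iff_has_vector_derivative)
    qed (use x in auto)
    then have h1: "(ev h has_integral c) {0..x}"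
      using x by (simp add: c_def w algebra_simps)
    have int: "(\<lambda>y. ev h y * ev h y) integrable_on {0..x}"
      using x by (intro integrable_continuous_real continuous_intros continuous_on_subset[OF continuous_on_ev]) auto
    then have h2: "((\<lambda>y. ev h y * ev h y) has_integral integral {0..x} (\<lambda>y. ev h y * ev h y)) {0..x}"
      by (rule integrable_integral)
    have h3: "((\<lambda>y. c * c) has_integral c * c * x) {0..x}"
      using has_integral_const_real[of "c * c" 0 x] x by (simp add: mult.commute)
    \<comment> \<open>Cauchy-Schwarz by hand: \<open>c\<close> is the integral of \<open>h\<close>
      over \<open>{0..x}\<close>, and the integrand is the square of \<open>h - c\<close>.
      Nonnegativity gives c^2 (2 - x) as a lower bound for the integral of h^2, and x is at most
      1.\<close>
    have "((\<lambda>y. ev h y * ev h y - 2 * c * ev h y + c * c) has_integral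
        integral {0..x} (\<lambda>y. ev h y * ev h y) - 2 * c * c + c * c * x) {0..x}"
      using has_integral_add[OF has_integral_diff[OF h2 has_integral_mult_right[OF h1, of "2 * c"]] h3]
      by (simp add: mult.assoc)
    then have "0 \<le> integral {0..x} (\<lambda>y. ev h y * ev h y) - 2 * c * c + c * c * x"
    proof (rule has_integral_nonneg)
      fix y
      have "0 \<le> (ev h y - c) * (ev h y - c)"
        by simp
      then show "0 \<le> ev h y * ev h y - 2 * c * ev h y + c * c"
        by (simp add: algebra_simps)
    qed
    moreover have "integral {0..x} (\<lambda>y. ev h y * ev h y) \<le> ip h h"
      unfolding ip_def using x by (intro integral_subset_le int integrable_ip) auto
    moreover have "c * c * x \<le> c * c"
      using x by (intro mult_left_le) auto
    ultimately have "c\<^sup>2 \<le> energy f"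
      using h by (simp add: power2_eq_square)
    from real_sqrt_le_mono[OF this] show ?thesis
      by (simp add: s_def c_def)
  qed
  then have "norm w \<le> s"
    by (rule norm_C01_le)
  have "P l = l"
    by (simp add: l_def blinfun.add_right blinfun.scaleR_right P_f0 P_f1)
  then have "P w = - l"
    by (simp add: w_def blinfun.diff_right P)
  then have "f = w - P w"
    by (simp add: w_def)
  then have "norm f \<le> norm w + norm (P w)"
    using norm_triangle_ineq4 by metis
  also have "\<dots> \<le> norm w + norm P * norm w"
    using norm_blinfun by (intro add_left_mono)
  also have "\<dots> = (1 + norm P) * norm w"
    by (simp add: algebra_simps)
  also have "\<dots> \<le> (1 + norm P) * s"
    using \<open>norm w \<le> s\<close> by (intro mult_left_mono) auto
  finally show ?thesis by (simp add: s_def)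
qed


section \<open>The spectral gap\<close>

text \<open>\<open>\<phi>\<close> is the derivative of the boundary expression v^2 \<mu> tan(\<mu>
  (x - m)), and it exceeds \<mu>^2 v^2 - v'^2 by the square of v' + \<mu> v tan(\<mu> (x -
  m)).\<close>

lemma tan_weight_integral:
  fixes v v' :: "real \<Rightarrow> real"
  assumes ab: "a \<le> b"
    and v: "\<And>x. x \<in> {a..b} \<Longrightarrow> (v has_real_derivative v' x) (at x within {a..b})"
    and cont: "continuous_on {a..b} v'"
    and cos: "\<And>x. x \<in> {a..b} \<Longrightarrow> cos (\<mu> * (x - m)) \<noteq> 0"
  shows "(v b)\<^sup>2 * (\<mu> * tan (\<mu> * (b - m))) - (v a)\<^sup>2 * (\<mu> * tan (\<mu> * (a - m))) \<ge>
    \<mu>\<^sup>2 * integral {a..b} (\<lambda>x. (v x)\<^sup>2) - integral {a..b} (\<lambda>x. (v' x)\<^sup>2)"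
proof -
  let ?t = "\<lambda>x. tan (\<mu> * (x - m))"
  define \<phi> where "\<phi> x = 2 * v x * v' x * \<mu> * ?t x + (v x)\<^sup>2 * \<mu>\<^sup>2 * (1 + (?t x)\<^sup>2)" for x
  have \<phi>: "(\<phi> has_integral (v b)\<^sup>2 * (\<mu> * ?t b) - (v a)\<^sup>2 * (\<mu> * ?t a)) {a..b}"
  proof (rule fundamental_theorem_of_calculus[OF ab])
    fix x
    assume x: "x \<in> {a..b}"
    have "inverse ((cos (\<mu> * (x - m)))\<^sup>2) = 1 + (?t x)\<^sup>2"
      using tan_sec[OF cos[OF x]] by (simp add: power_inverse)
    then have "((\<lambda>x. (v x)\<^sup>2 * (\<mu> * ?t x)) has_real_derivative \<phi> x) (at x within {a..b})"
      using v[OF x] cos[OF x]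
      by (auto intro!: derivative_eq_intros simp: \<phi>_def power2_eq_square algebra_simps)
    then show "((\<lambda>x. (v x)\<^sup>2 * (\<mu> * ?t x)) has_vector_derivative \<phi> x) (at x within {a..b})"
      by (simp add: has_real_derivative_iff_has_vector_derivative)
  qed
  have "((\<lambda>x. \<mu>\<^sup>2 * (v x)\<^sup>2 - (v' x)\<^sup>2) has_integral
      \<mu>\<^sup>2 * integral {a..b} (\<lambda>x. (v x)\<^sup>2) - integral {a..b} (\<lambda>x. (v' x)\<^sup>2)) {a..b}"
    using DERIV_continuous_on[OF v] cont
    by (intro has_integral_diff has_integral_mult_right integrable_integral integrable_continuous_real
        continuous_intros)
  from this \<phi> show ?thesis
  proof (rule has_integral_le)
    fix x
    have "0 \<le> (v' x + \<mu> * v x * ?t x)\<^sup>2"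
      by simp
    then show "\<mu>\<^sup>2 * (v x)\<^sup>2 - (v' x)\<^sup>2 \<le> \<phi> x"
      by (simp add: \<phi>_def power2_eq_square algebra_simps)
  qed
qed

text \<open>
  A function with $v(0) = v(1)$ that also vanishes at two points at distance $1/2$ satisfies the
  Dirichlet inequality on both half periods; on the one through $0 \sim 1$ the boundary terms cancel.
\<close>

lemma periodic_poincare:
  fixes w w' :: "real \<Rightarrow> real"
  assumes w: "\<And>x. x \<in> {0..1} \<Longrightarrow> (w has_real_derivative w' x) (at x within {0..1})"
    and cont: "continuous_on {0..1} w'"
    and per: "w 0 = w 1"
    and \<mu>: "0 < \<mu>" "\<mu> < 2 * pi"
  obtains c where "\<mu>\<^sup>2 * integral {0..1} (\<lambda>x. (w x - c)\<^sup>2) \<le> integral {0..1} (\<lambda>x. (w' x)\<^sup>2)"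
proof -
  have cw: "continuous_on {0..1} w"
    using w by (rule DERIV_continuous_on)
  \<comment> \<open>By \<open>per\<close>, the difference w(x) - w(x + 1/2) takes opposite values at
    0 and 1/2, so it vanishes in between. The common value \<open>w a\<close> will serve as
    \<open>c\<close>.\<close>
  have "\<exists>a\<in>{0..1/2}. w a = w (a + 1/2)"
  proof -
    have c: "continuous_on {0..1/2} (\<lambda>x. w x - w (x + 1/2))"
      by (intro continuous_intros continuous_on_compose2[OF cw]) auto
    have "w 0 - w (0 + 1/2) = - (w (1/2) - w (1/2 + 1/2))"
      using per by simp
    then consider "w 0 - w (0 + 1/2) \<le> 0" "0 \<le> w (1/2) - w (1/2 + 1/2)" |
        "0 \<le> w 0 - w (0 + 1/2)" "w (1/2) - w (1/2 + 1/2) \<le> 0"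
      by linarith
    then show ?thesis
    proof cases
      case 1
      from IVT'[OF this _ c] show ?thesis by force
    next
      case 2
      from IVT2'[OF this(2,1) _ c] show ?thesis by force
    qed
  qed
  then obtain a where a: "0 \<le> a" "a \<le> 1/2" "w (a + 1/2) = w a"
    by force
  define v where "v x = w x - w a" for x
  have v: "(v has_real_derivative w' x) (at x within {p..q})" if "x \<in> {p..q}" "{p..q} \<subseteq> {0..1}" for x p q
    using w[of x] that unfolding v_def
    by (auto intro!: derivative_eq_intros intro: DERIV_subset)
  \<comment> \<open>Here \<open>\<mu> < 2 * pi\<close> enters: on an interval of half length 1/4
    about \<open>m\<close> the tangent has no pole.\<close>
  have cos: "cos (\<mu> * (x - m)) \<noteq> 0" if "m - 1/4 \<le> x" "x \<le> m + 1/4" for x m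
  proof -
    have "\<bar>x - m\<bar> \<le> 1/4"
      using that by linarith
    then have "\<mu> * \<bar>x - m\<bar> \<le> \<mu> * (1/4)"
      using \<mu> by (intro mult_left_mono) auto
    also have "\<dots> < pi / 2"
      using \<mu> by simp
    finally have "\<bar>\<mu> * (x - m)\<bar> < pi / 2"
      using \<mu> by (simp add: abs_mult)
    then have "- (pi / 2) < \<mu> * (x - m)" "\<mu> * (x - m) < pi / 2"
      by linarith+
    then show ?thesis
      using cos_gt_zero_pi[of "\<mu> * (x - m)"] by simp
  qed
  have I: "(v q)\<^sup>2 * (\<mu> * tan (\<mu> * (q - m))) - (v p)\<^sup>2 * (\<mu> * tan (\<mu> * (p - m))) \<ge>
      \<mu>\<^sup>2 * integral {p..q} (\<lambda>x. (v x)\<^sup>2) - integral {p..q} (\<lambda>x. (w' x)\<^sup>2)"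
    if "0 \<le> p" "p \<le> q" "q \<le> 1" "m - 1/4 \<le> p" "q \<le> m + 1/4" for p q m
    using that by (intro tan_weight_integral v continuous_on_subset[OF cont] cos) auto
  have split: "integral {0..1} g = integral {0..a} g + integral {a..a+1/2} g + integral {a+1/2..1} g"
    if "continuous_on {0..1} g" for g :: "real \<Rightarrow> real"
  proof -
    have g: "g integrable_on {0..1}"
      using that by (rule integrable_continuous_real)
    have "integral {0..1} g = integral {0..a} g + integral {a..1} g"
      using a Henstock_Kurzweil_Integration.integral_combine[OF _ _ g, of a] by simp
    moreover have "integral {a..1} g = integral {a..a+1/2} g + integral {a+1/2..1} g"
      using a Henstock_Kurzweil_Integration.integral_combine[of a "a+1/2" 1 g] integrable_on_subinterval[OF g, of a 1] by simp
    ultimately show ?thesis by simp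
  qed
  have v0: "v a = 0" "v (a + 1/2) = 0" "v 0 = v 1"
    using a per by (simp_all add: v_def)
  \<comment> \<open>The half period through 0 and 1 is split into \<open>{0..a}\<close> and
    \<open>{a+1/2..1}\<close>, with centres one period apart. So the tangents at 0 and 1 agree, and
    \<open>v 0 = v 1\<close> makes their boundary terms cancel; those at \<open>a\<close> and
    \<open>a + 1/2\<close> vanish with \<open>v\<close>.\<close>
  have t: "\<mu> * (1 - (a + 3/4)) = \<mu> * (0 - (a - 1/4))"
    by (simp add: algebra_simps)
  have "\<mu>\<^sup>2 * integral {0..1} (\<lambda>x. (v x)\<^sup>2) \<le> integral {0..1} (\<lambda>x. (w' x)\<^sup>2)"
    using I[of 0 a "a - 1/4"] I[of a "a + 1/2" "a + 1/4"] I[of "a + 1/2" 1 "a + 3/4"] a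
      split[of "\<lambda>x. (v x)\<^sup>2"] split[of "\<lambda>x. (w' x)\<^sup>2"] cw cont
    by (simp add: v0 t per continuous_intros distrib_left v_def[abs_def])
  then show thesis
    unfolding v_def by (rule that)
qed

text \<open>Without its linear drift, \<open>f\<close> has equal endpoint values and derivative
  \<open>h\<close>, so the periodic inequality applies up to a constant \<open>c\<close>. Drift and
  constant form an affine function orthogonal to \<open>f\<close>, and subtracting it can only
  increase the squared norm.\<close>

lemma spectral_gap:
  assumes f: "f \<in> C1" and P: "P f = 0" and \<mu>: "0 < \<mu>" "\<mu> < 2 * pi"
  shows "\<mu>\<^sup>2 * ip f f \<le> energy f"
proof -
  define d where "d = ev f 1 - ev f 0"
  have der: "has_deriv01 f (deriv01 f)"
    using f by (rule has_deriv01_deriv01)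
  define h where "h = deriv01 f - d *\<^sub>R f0"
  have h: "ip h h = energy f"
    using energy_eq_ip[OF f] by (simp add: h_def d_def)
  have w: "((\<lambda>x. ev f x - d * x) has_real_derivative ev h x) (at x within {0..1})" if "x \<in> {0..1}" for x
    using der that
    by (auto simp: h_def ev_diff ev_scaleR ev_f0 has_deriv01_def intro!: derivative_eq_intros)
  obtain c where c: "\<mu>\<^sup>2 * integral {0..1} (\<lambda>x. (ev f x - d * x - c)\<^sup>2) \<le> integral {0..1} (\<lambda>x. (ev h x)\<^sup>2)"
    by (rule periodic_poincare[OF w continuous_on_ev _ \<mu>]) (auto simp: d_def)
  define l where "l = (c + d / 2) *\<^sub>R f0 + (d / 12) *\<^sub>R f1"
  have "ip f l = 0"
    using P by (simp add: l_def P_eq_0_iff ip.add_right ip.scaleR_right)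
  then have "ip f f \<le> ip (f - l) (f - l)"
    using ip_self_nonneg[of l] by (simp add: ip.diff_left ip.diff_right ip_commute[of l f])
  also have "\<dots> = integral {0..1} (\<lambda>x. (ev f x - d * x - c)\<^sup>2)"
    unfolding ip_def
    by (intro integral_cong) (simp add: l_def ev_diff ev_add ev_scaleR ev_f0 ev_f1 power2_eq_square algebra_simps)
  finally have "\<mu>\<^sup>2 * ip f f \<le> \<mu>\<^sup>2 * integral {0..1} (\<lambda>x. (ev f x - d * x - c)\<^sup>2)"
    by (intro mult_left_mono) auto
  also note c
  also have "integral {0..1} (\<lambda>x. (ev h x)\<^sup>2) = energy f"
    using h by (simp add: ip_def power2_eq_square)
  finally show ?thesis .
qed

section \<open>The second largest eigenvalue\<close>

lemma eigenvalue_cos: "eigenvalue dom_A op_A (- (4 * pi\<^sup>2))"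
proof -
  \<comment> \<open>Equal endpoint values and zero slope at both ends satisfy the boundary
    conditions.\<close>
  define f where "f = C01_of (\<lambda>x. cos (2 * pi * x))"
  define g where "g = C01_of (\<lambda>x. - (2 * pi * sin (2 * pi * x)))"
  define h where "h = C01_of (\<lambda>x. - (4 * pi\<^sup>2) * cos (2 * pi * x))"
  have ev: "ev f x = cos (2 * pi * x)" "ev g x = - (2 * pi * sin (2 * pi * x))"
    "ev h x = - (4 * pi\<^sup>2) * cos (2 * pi * x)" if "x \<in> {0..1}" for x
    using that by (auto simp: f_def g_def h_def intro!: ev_C01_of continuous_intros)
  have "has_deriv01 f g"
    unfolding f_def g_def by (rule has_deriv01_C01_of) (auto intro!: derivative_eq_intros continuous_intros)
  moreover have "has_deriv01 g h"
    unfolding g_def h_def by (rule has_deriv01_C01_of)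
      (auto intro!: derivative_eq_intros continuous_intros simp: power2_eq_square)
  ultimately have "f \<in> dom_A" "op_A f = h"
    by (rule dom_AI; simp add: ev)+
  moreover have "h = - (4 * pi\<^sup>2) *\<^sub>R f"
    by (rule C01_eqI) (simp add: ev ev_scaleR del: scaleR_minus_left)
  moreover have "f \<noteq> 0"
    using ev(1)[of 0] by auto
  ultimately show ?thesis
    unfolding eigenvalue_def by blast
qed

text \<open>By symmetry, an eigenfunction for a nonzero eigenvalue is orthogonal to the kernel, so
  the spectral gap bounds its Rayleigh quotient.\<close>

lemma negative_eigenvalue_le:
  assumes "eigenvalue dom_A op_A \<mu>" "\<mu> < 0"
  shows "\<mu> \<le> - (4 * pi\<^sup>2)"
proof (rule ccontr)
  assume *: "\<not> ?thesis"
  obtain f where f: "f \<in> dom_A" "f \<noteq> 0" "op_A f = \<mu> *\<^sub>R f"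
    using assms(1) by (auto simp: eigenvalue_def)
  have "\<mu> * ip f k = 0" if "k \<in> dom_A" "op_A k = 0" for k
    using op_A_symmetric[OF f(1) that(1)] f(3) that(2) by (simp add: ip.scaleR_left ip.zero_right)
  then have P: "P f = 0"
    using assms(2) f0_in_dom_A op_A_f0 f1_in_dom_A op_A_f1 by (simp add: P_eq_0_iff)
  have "sqrt (- \<mu>) < sqrt (4 * pi\<^sup>2)"
    using * by (intro real_sqrt_less_mono) simp
  then have "sqrt (- \<mu>) < 2 * pi"
    by (simp add: real_sqrt_mult)
  \<comment> \<open>The gap inequality is available only strictly below \<open>2 * pi\<close>; an
    intermediate \<open>\<nu>\<close> still contradicts the energy being exactly
    \<open>- \<mu> * ip f f\<close>.\<close>
  then obtain \<nu> where \<nu>: "sqrt (- \<mu>) < \<nu>" "\<nu> < 2 * pi"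
    using dense by blast
  have "0 < sqrt (- \<mu>)"
    using assms(2) by simp
  then have "0 < \<nu>"
    using \<nu>(1) by (rule less_trans)
  have "(sqrt (- \<mu>))\<^sup>2 < \<nu>\<^sup>2"
    using \<nu> assms(2) by (intro power_strict_mono) auto
  then have "- \<mu> < \<nu>\<^sup>2"
    using assms(2) by simp
  moreover have "ip f f > 0"
    using ip_self_nonneg[of f] ip_self_eq_0[of f] f(2) by linarith
  ultimately have "- \<mu> * ip f f < \<nu>\<^sup>2 * ip f f"
    by (rule mult_strict_right_mono)
  also have "\<dots> \<le> energy f"
    using \<nu>(2) \<open>0 < \<nu>\<close> f(1) P by (intro spectral_gap) (auto simp: dom_A_def C2_def)
  also have "\<dots> = - \<mu> * ip f f"
    using f by (simp add: energy_eq ip.scaleR_left)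
  finally show False
    by simp
qed

lemma second_largest_eigenvalue_eq: "second_largest_eigenvalue = - (4 * pi\<^sup>2)"
  unfolding second_largest_eigenvalue_def
  by (rule Greatest_equality) (simp_all add: eigenvalue_cos negative_eigenvalue_le)


section \<open>Decay of the semigroup\<close>

locale krein_semigroup = C0_semigroup_generator T dom_A op_A
  for T :: "real \<Rightarrow> C01 \<Rightarrow>\<^sub>L C01"
begin

text \<open>The orbit has derivative \<open>T s (op_A k) = 0\<close>, so it is constant.\<close>

lemma T_kernel:
  assumes k: "k \<in> dom_A" "op_A k = 0" and t: "t \<ge> 0"
  shows "T t k = k"
proof (cases "t = 0")
  case False
  have "norm (T t k - T 0 k) \<le> (0::real) - 0"
  proof (rule differentiable_bound_general[where \<phi> = "\<lambda>_. 0" and \<phi>' = "\<lambda>_. 0"])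
    show "continuous_on {0..t} (\<lambda>t. T t k)"
      by (rule continuous_on_subset[OF continuous_on_T]) auto
    show "((\<lambda>t. T t k) has_vector_derivative T s (op_A k)) (at s)" if "0 < s" for s
      using has_vector_derivative_T[OF k(1) that] .
  qed (use False t k in \<open>auto simp: blinfun.zero_right\<close>)
  then show ?thesis by simp
qed simp

lemma T_P: "t \<ge> 0 \<Longrightarrow> T t (P f) = P f"
  using T_kernel[of f0 t] T_kernel[of f1 t] f0_in_dom_A op_A_f0 f1_in_dom_A op_A_f1
  by (simp add: P_eq blinfun.add_right blinfun.scaleR_right)

text \<open>\<open>P f\<close> is fixed by the semigroup, so its difference quotients are
  zero.\<close>

lemma P_in_dom_A: "P f \<in> dom_A" and op_A_P: "op_A (P f) = 0"
proof -
  have "((\<lambda>h. (T h (P f) - P f) /\<^sub>R h) \<longlongrightarrow> 0) (at_right 0)"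
    by (rule tendsto_eventually) (auto simp: eventually_at_right_field T_P intro!: exI[of _ 1])
  from generatorI[OF this] show "P f \<in> dom_A" "op_A (P f) = 0" .
qed

lemma has_real_derivative_ip_T:
  assumes "f \<in> dom_A" "g \<in> dom_A" "t > 0"
  shows "((\<lambda>t. ip (T t f) (T t g)) has_real_derivative
    ip (T t (op_A f)) (T t g) + ip (T t f) (T t (op_A g))) (at t)"
  using ip.has_vector_derivative[OF has_vector_derivative_T[OF assms(1,3)] has_vector_derivative_T[OF assms(2,3)]]
  by (simp add: has_real_derivative_iff_has_vector_derivative add.commute)

lemma continuous_on_ip_T:
  assumes "a \<ge> 0"
  shows "continuous_on {a..b} (\<lambda>t. ip (T t f) (T t g))"
  using assms by (intro ip.continuous_on continuous_on_subset[OF continuous_on_T]) auto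

text \<open>By symmetry of the operator, the inner product of the orbit with a kernel element is
  conserved, and \<open>P\<close> depends only on the products with \<open>f0\<close> and
  \<open>f1\<close>.\<close>

lemma P_T:
  assumes f: "f \<in> dom_A" and t: "t \<ge> 0"
  shows "P (T t f) = P f"
proof -
  have "ip (T t f) k = ip f k" if k: "k \<in> dom_A" "op_A k = 0" for k
  proof (cases "t = 0")
    case False
    have "ip (T t f) (T t k) = ip (T 0 f) (T 0 k)"
    proof (rule DERIV_isconst_end[where f = "\<lambda>t. ip (T t f) (T t k)"])
      fix s :: real
      assume s: "0 < s"
      have "ip (T s (op_A f)) (T s k) = 0"
        using op_A_symmetric[OF T_generator(1)[OF f, of s] k(1)] s k
        by (simp add: T_generator f T_kernel ip.zero_right)
      with has_real_derivative_ip_T[OF f k(1) s]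
      show "DERIV (\<lambda>t. ip (T t f) (T t k)) s :> 0"
        by (simp add: k(2) blinfun.zero_right ip.zero_right)
    qed (use t False continuous_on_ip_T in auto)
    with k t show ?thesis
      by (simp add: T_kernel)
  qed simp
  then show ?thesis
    using f0_in_dom_A op_A_f0 f1_in_dom_A op_A_f1 by (simp add: P_eq)
qed

section \<open>Decay of the L2 norm and of the energy\<close>

lemma DERIV_ip_T:
  assumes "f \<in> dom_A" "t > 0"
  shows "((\<lambda>t. ip (T t f) (T t f)) has_real_derivative - 2 * energy (T t f)) (at t)"
  using has_real_derivative_ip_T[OF assms(1,1,2)] T_generator[OF assms(1), of t] assms(2)
  by (simp add: energy_eq ip_commute[of "T t f"])

text \<open>Gronwall argument: the orbit stays in the complement of the kernel by
  \<open>P_T\<close>, so the spectral gap makes the squared norm times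
  \<open>exp (2 * \<mu>\<^sup>2 * t)\<close> nonincreasing.\<close>

lemma ip_T_decay:
  assumes f: "f \<in> dom_A" "P f = 0" and \<mu>: "0 < \<mu>" "\<mu> < 2 * pi" and t: "t \<ge> 0"
  shows "ip (T t f) (T t f) \<le> exp (- 2 * \<mu>\<^sup>2 * t) * ip f f"
proof (cases "t = 0")
  case False
  let ?E = "\<lambda>t. ip (T t f) (T t f)"
  have "exp (2 * \<mu>\<^sup>2 * t) * ?E t \<le> exp (2 * \<mu>\<^sup>2 * 0) * ?E 0"
  proof (rule DERIV_nonpos_imp_decreasing_open[where f = "\<lambda>s. exp (2 * \<mu>\<^sup>2 * s) * ?E s"])
    fix s
    assume s: "0 < s" "s < t"
    have "\<mu>\<^sup>2 * ?E s \<le> energy (T s f)"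
      using s f T_generator(1)[OF f(1), of s] P_T[of f s]
      by (intro spectral_gap \<mu>) (auto simp: dom_A_def C2_def)
    then have "exp (2 * \<mu>\<^sup>2 * s) * (2 * (\<mu>\<^sup>2 * ?E s) - 2 * energy (T s f)) \<le> 0"
      by (intro mult_nonneg_nonpos) auto
    moreover have "DERIV (\<lambda>s. exp (2 * \<mu>\<^sup>2 * s) * ?E s) s :>
        exp (2 * \<mu>\<^sup>2 * s) * (2 * (\<mu>\<^sup>2 * ?E s) - 2 * energy (T s f))"
      using DERIV_ip_T[OF f(1) s(1)] by (auto intro!: derivative_eq_intros simp: algebra_simps)
    ultimately show "\<exists>y. DERIV (\<lambda>s. exp (2 * \<mu>\<^sup>2 * s) * ?E s) s :> y \<and> y \<le> 0"
      by blast
  qed (use t in \<open>auto intro!: continuous_intros continuous_on_ip_T\<close>)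
  then show ?thesis
    by (simp add: exp_minus field_simps)
qed simp

text \<open>By symmetry, the energy along the orbit has derivative -2 times the squared L2 norm of
  \<open>T r (op_A f)\<close>. Differentiating requires the orbit of \<open>op_A f\<close> to be
  differentiable as well.\<close>

lemma energy_T_antimono:
  assumes f: "f \<in> dom_A" "op_A f \<in> dom_A" and st: "0 < s" "s \<le> t"
  shows "energy (T t f) \<le> energy (T s f)"
proof -
  have eq: "energy (T r f) = - ip (T r (op_A f)) (T r f)" if "r > 0" for r
    using that f by (simp add: energy_eq T_generator)
  have "- ip (T t (op_A f)) (T t f) \<le> - ip (T s (op_A f)) (T s f)"
  proof (rule DERIV_nonpos_imp_nonincreasing[OF st(2)])
    fix r
    assume "s \<le> r"
    then have r: "0 < r"
      using st by simp
    have "ip (T r (op_A (op_A f))) (T r f) = ip (T r (op_A f)) (T r (op_A f))"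
      using op_A_symmetric[of "T r (op_A f)" "T r f"] r f by (simp add: T_generator)
    then have "DERIV (\<lambda>r. - ip (T r (op_A f)) (T r f)) r :> - 2 * ip (T r (op_A f)) (T r (op_A f))"
      using DERIV_minus[OF has_real_derivative_ip_T[OF f(2,1) r]] by simp
    then show "\<exists>y. DERIV (\<lambda>r. - ip (T r (op_A f)) (T r f)) r :> y \<and> y \<le> 0"
      using ip_self_nonneg by (intro exI conjI) auto
  qed
  then show ?thesis
    using st by (simp add: eq)
qed

lemma energy_T_le:
  assumes f: "f \<in> dom_A" "op_A f \<in> dom_A" and t: "t \<ge> 0"
  shows "2 * energy (T (t + 1) f) \<le> ip (T t f) (T t f)"
proof -
  let ?E = "\<lambda>t. ip (T t f) (T t f)" and ?e = "energy (T (t + 1) f)"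
  \<comment> \<open>The squared norm falls at rate twice the energy, which on this unit interval is
    at least its final value \<open>?e\<close>; the linear term compensates exactly that guaranteed
    loss.\<close>
  have "?E (t + 1) + 2 * ?e * (t + 1) \<le> ?E t + 2 * ?e * t"
  proof (rule DERIV_nonpos_imp_decreasing_open[where f = "\<lambda>s. ?E s + 2 * ?e * s"])
    fix s
    assume s: "t < s" "s < t + 1"
    then have "DERIV (\<lambda>s. ?E s + 2 * ?e * s) s :> - 2 * energy (T s f) + 2 * ?e"
      using t by (auto intro!: derivative_eq_intros DERIV_ip_T f)
    moreover have "?e \<le> energy (T s f)"
      using s t by (intro energy_T_antimono f) auto
    ultimately show "\<exists>y. DERIV (\<lambda>s. ?E s + 2 * ?e * s) s :> y \<and> y \<le> 0"
      by (intro exI conjI) auto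
  qed (use t in \<open>auto intro!: continuous_intros continuous_on_ip_T\<close>)
  then show ?thesis
    using ip_self_nonneg[of "T (t + 1) f"] by (simp add: algebra_simps)
qed

section \<open>Convergence in operator norm\<close>

lemma norm_T_decay:
  assumes f: "f \<in> dom_A" "op_A f \<in> dom_A" "P f = 0"
    and \<mu>: "0 < \<mu>" "\<mu> < 2 * pi" and t: "t \<ge> 0"
  shows "norm (T (t + 1) f) \<le> (1 + norm P) * exp (- \<mu>\<^sup>2 * t) * norm f"
proof -
  have "T (t + 1) f \<in> C1"
    using T_generator(1)[OF f(1), of "t + 1"] t by (auto simp: dom_A_def C2_def)
  then have "norm (T (t + 1) f) \<le> (1 + norm P) * sqrt (energy (T (t + 1) f))"
    using t f by (intro norm_le_energy) (simp_all add: P_T)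
  also have "sqrt (energy (T (t + 1) f)) \<le> exp (- \<mu>\<^sup>2 * t) * norm f"
  proof (rule real_le_lsqrt)
    \<comment> \<open>One unit of time is spent on smoothing: the energy at \<open>t + 1\<close> is
      bounded by the L2 norm at \<open>t\<close>.\<close>
    have "2 * energy (T (t + 1) f) \<le> exp (- 2 * \<mu>\<^sup>2 * t) * ip f f"
      using energy_T_le[OF f(1,2) t] ip_T_decay[OF f(1,3) \<mu> t] by simp
    also have "\<dots> \<le> exp (- 2 * \<mu>\<^sup>2 * t) * (norm f * norm f)"
      using abs_ip_le[of f f] by (intro mult_left_mono) auto
    also have "\<dots> = (exp (- \<mu>\<^sup>2 * t) * norm f)\<^sup>2"
      by (simp add: power2_eq_square flip: exp_add)
    finally show "energy (T (t + 1) f) \<le> (exp (- \<mu>\<^sup>2 * t) * norm f)\<^sup>2"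
      using zero_le_power2[of "exp (- \<mu>\<^sup>2 * t) * norm f"] by linarith
  qed simp
  finally show ?thesis
    by (simp add: mult_left_mono mult.assoc)
qed

text \<open>As \<open>T\<close> fixes \<open>P f\<close>, the difference is the orbit of
  \<open>f - P f\<close>, whose norm costs a second factor \<open>1 + norm P\<close>. The estimate
  is a closed condition on \<open>f\<close>, so density of the domain of the square
  suffices.\<close>

lemma norm_T_diff_P_decay:
  assumes \<mu>: "0 < \<mu>" "\<mu> < 2 * pi" and t: "t \<ge> 0"
  shows "norm (T (t + 1) - P) \<le> (1 + norm P)\<^sup>2 * exp (- \<mu>\<^sup>2 * t)"
proof (rule norm_blinfun_bound)
  let ?C = "(1 + norm P)\<^sup>2 * exp (- \<mu>\<^sup>2 * t)"
  fix f
  have "closed {f. norm (T (t + 1) f - P f) \<le> ?C * norm f}"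
    by (intro closed_Collect_le continuous_intros)
  moreover have "{f \<in> dom_A. op_A f \<in> dom_A} \<subseteq> {f. norm (T (t + 1) f - P f) \<le> ?C * norm f}"
  proof clarify
    fix f
    assume f: "f \<in> dom_A" "op_A f \<in> dom_A"
    define g where "g = f - P f"
    have g: "g \<in> dom_A" "op_A g \<in> dom_A" "P g = 0"
      using generator_diff_scale[OF f(1) P_in_dom_A, of 1 f] f(2)
      by (simp_all add: g_def op_A_P blinfun.diff_right P_idem)
    have "norm (T (t + 1) f - P f) = norm (T (t + 1) g)"
      using t by (simp add: g_def blinfun.diff_right T_P)
    also have "\<dots> \<le> (1 + norm P) * exp (- \<mu>\<^sup>2 * t) * norm g"
      by (rule norm_T_decay[OF g \<mu> t])
    also have "\<dots> \<le> (1 + norm P) * exp (- \<mu>\<^sup>2 * t) * ((1 + norm P) * norm f)"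
      using norm_triangle_ineq4[of f "P f"] norm_blinfun[of P f]
      by (intro mult_left_mono) (simp_all add: g_def algebra_simps)
    finally show "norm (T (t + 1) f - P f) \<le> ?C * norm f"
      by (simp add: power2_eq_square mult_ac)
  qed
  ultimately have "closure {f \<in> dom_A. op_A f \<in> dom_A} \<subseteq> {f. norm (T (t + 1) f - P f) \<le> ?C * norm f}"
    by (intro closure_minimal)
  then show "norm ((T (t + 1) - P) f) \<le> ?C * norm f"
    unfolding closure_generator_domain2 by (auto simp: blinfun.diff_left)
qed simp

lemma exponential_convergence:
  assumes "0 < \<epsilon>" "\<epsilon> < 4 * pi\<^sup>2"
  shows "\<exists>M. \<forall>t\<ge>0. norm (T t - P) \<le> M * exp (- \<epsilon> * t)"
proof -
  have "sqrt \<epsilon> < sqrt (4 * pi\<^sup>2)"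
    using assms by (intro real_sqrt_less_mono)
  then have \<mu>: "0 < sqrt \<epsilon>" "sqrt \<epsilon> < 2 * pi"
    using assms by (simp_all add: real_sqrt_mult)
  obtain K where K: "\<And>t. t \<in> {0..1} \<Longrightarrow> norm (T t) \<le> K"
    using T_bounded by blast
  define M where "M = max (K + norm P) ((1 + norm P)\<^sup>2)"
  have "M \<ge> 0"
    by (simp add: M_def le_max_iff_disj)
  \<comment> \<open>The decay estimate with \<open>\<mu> = sqrt \<epsilon>\<close> starts at time 1;
    the factor \<open>exp \<epsilon>\<close> pays for that delay, and on \<open>{0..1}\<close> the
    local bound \<open>K\<close> is enough.\<close>
  have "norm (T t - P) \<le> M * exp \<epsilon> * exp (- \<epsilon> * t)" if t: "t \<ge> 0" for t
  proof (cases "t \<le> 1")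
    case True
    have "norm (T t - P) \<le> M"
      using norm_triangle_ineq4[of "T t" P] K[of t] t True by (simp add: M_def)
    also have "\<dots> \<le> M * exp (\<epsilon> * (1 - t))"
      using \<open>M \<ge> 0\<close> True assms by (simp add: mult_le_cancel_left1)
    finally show ?thesis
      by (simp add: algebra_simps flip: exp_add)
  next
    case False
    have "norm (T ((t - 1) + 1) - P) \<le> (1 + norm P)\<^sup>2 * exp (- \<epsilon> * (t - 1))"
      using norm_T_diff_P_decay[OF \<mu>, of "t - 1"] False assms by simp
    also have "\<dots> \<le> M * exp (- \<epsilon> * (t - 1))"
      by (simp add: M_def)
    finally show ?thesis
      by (simp add: algebra_simps flip: exp_add)
  qed
  then show ?thesis by blast
qed

lemma tendsto_P: "(T \<longlongrightarrow> P) at_top"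
proof -
  \<comment> \<open>Any admissible rate gives convergence; 1 is a convenient one.\<close>
  have "4 * pi\<^sup>2 > 1"
    using pi_gt3 power_strict_mono[of 3 pi 2] by simp
  then obtain M where M: "\<And>t. t \<ge> 0 \<Longrightarrow> norm (T t - P) \<le> M * exp (- 1 * t)"
    using exponential_convergence[of 1] by auto
  have "((\<lambda>t. M * exp (- t)) \<longlongrightarrow> M * 0) at_top"
    by (intro tendsto_intros filterlim_compose[OF exp_at_bot] filterlim_uminus_at_bot_at_top)
  then have "((\<lambda>t. M * exp (- t)) \<longlongrightarrow> 0) at_top"
    by simp
  moreover have "\<forall>\<^sub>F t in at_top. norm (T t - P) \<le> M * exp (- t)"
    using eventually_ge_at_top[of 0] by (rule eventually_mono) (use M in simp)
  ultimately have "((\<lambda>t. T t - P) \<longlongrightarrow> 0) at_top"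
    by (rule Lim_null_comparison[rotated])
  then show ?thesis
    by (rule LIM_zero_cancel)
qed

end

theorem theorem4p3:
  fixes T :: "real \<Rightarrow> C01 \<Rightarrow>\<^sub>L C01"
  assumes "C0_semigroup T" and "generator T dom_A op_A"
  shows "P o\<^sub>L P = P \<and> dim (range (blinfun_apply P)) = 2 \<and>
    (T \<longlongrightarrow> P) at_top \<and>
    (\<forall>\<epsilon>>0. - \<epsilon> > second_largest_eigenvalue \<longrightarrow>
      (\<exists>M. \<forall>t\<ge>0. norm (T t - P) \<le> M * exp (- \<epsilon> * t)))"
proof -
  interpret krein_semigroup T
    by unfold_locales (rule assms)+
  have "P o\<^sub>L P = P"
    by (rule blinfun_eqI) (simp add: P_idem)
  \<comment> \<open>With the eigenvalue computed, the condition on the rate reads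
    \<open>\<epsilon> < 4 * pi\<^sup>2\<close>.\<close>
  then show ?thesis
    using dim_range_P tendsto_P exponential_convergence
    unfolding second_largest_eigenvalue_eq neg_less_iff_less by blast
qed

end
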